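(* For every fixed chain graph $H$, the class of $H$-free chordal bipartite graphs admits an implicit representation.
   Context: All graphs are finite and simple. $G$ is $H$-free if it has no induced subgraph isomorphic to $H$. A chain graph is a bipartite graph whose vertices in one of the parts can be linearly ordered with respect to inclusion of their neighbourhoods (equivalently, a $2K_2$-free bipartite graph). A bipartite graph is chordal bipartite if it has no induced cycles of length at least $6$. A class $\mathcal X$ of graphs admits an implicit representation if there are a constant $c$ and a function $f:\{0,1\}^*\times\{0,1\}^*\to\{0,1\}$ (depending only on $\mathcal X$) such that for every $n\ge 2$ and every $n$-vertex graph $G\in\mathcal X$ one can assign to each vertex $x$ of $G$ a binary code $\ell(x)$ of length at most $c\log n$ so that distinct vertices $x,y$ are adjacent in $G$ if and only if $f(\ell(x),\ell(y))=1$. *)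

theory Defs
  imports Complex_Main "Graph_Theory.Graph_Theory"
begin

text \<open>
  Finite simple graphs are the digraphs satisfying \<^locale>\<open>pair_graph\<close> (finite, loop-free,
  symmetric, no parallel arcs): an undirected edge \<open>uv\<close> is the pair of arcs \<open>(u, v)\<close>, \<open>(v, u)\<close>.
\<close>

definition free_of :: "'b pair_pre_digraph \<Rightarrow> 'a pair_pre_digraph \<Rightarrow> bool" where
  "free_of H G \<longleftrightarrow>
     \<not> (\<exists>K. induced_subgraph K (with_proj G) \<and> digraph_iso K (with_proj H))"

definition neighbourhood :: "'a pair_pre_digraph \<Rightarrow> 'a \<Rightarrow> 'a set" where
  "neighbourhood G u = {v. (u, v) \<in> parcs G}"

definition bipartition :: "'a pair_pre_digraph \<Rightarrow> 'a set \<Rightarrow> 'a set \<Rightarrow> bool" where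
  "bipartition G A B \<longleftrightarrow>
     A \<union> B = pverts G \<and> A \<inter> B = {} \<and>
     (\<forall>(u, v) \<in> parcs G. u \<in> A \<and> v \<in> B \<or> u \<in> B \<and> v \<in> A)"

definition bipartite_graph :: "'a pair_pre_digraph \<Rightarrow> bool" where
  "bipartite_graph G \<longleftrightarrow> pair_graph G \<and> (\<exists>A B. bipartition G A B)"

text \<open>
  The distinguished part is called \<open>A\<close>; this loses no generality since
  \<^const>\<open>bipartition\<close> is symmetric in its two parts. The list is the linear order.
\<close>

definition chain_graph :: "'a pair_pre_digraph \<Rightarrow> bool" where
  "chain_graph G \<longleftrightarrow> pair_graph G \<and>
     (\<exists>A B. bipartition G A B \<and>
        (\<exists>xs. distinct xs \<and> set xs = A \<and>
           sorted_wrt (\<lambda>x y. neighbourhood G x \<subseteq> neighbourhood G y) xs))"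

definition cycle_graph :: "nat \<Rightarrow> nat pair_pre_digraph" where
  "cycle_graph k =
     \<lparr> pverts = {..<k},
       parcs = {(i, j). i < k \<and> j < k \<and> (j = (i + 1) mod k \<or> i = (j + 1) mod k)} \<rparr>"

definition chordal_bipartite :: "'a pair_pre_digraph \<Rightarrow> bool" where
  "chordal_bipartite G \<longleftrightarrow> bipartite_graph G \<and> (\<forall>k\<ge>6. free_of (cycle_graph k) G)"

text \<open>
  Binary codes are lists of Booleans. The base of the logarithm is immaterial, as it only
  rescales \<open>c\<close>.
\<close>

definition admits_implicit_representation :: "'a pair_pre_digraph set \<Rightarrow> bool" where
  "admits_implicit_representation X \<longleftrightarrow>
     (\<exists>(c :: real) (f :: bool list \<Rightarrow> bool list \<Rightarrow> bool).
        \<forall>n\<ge>2. \<forall>G\<in>X. card (pverts G) = n \<longrightarrow>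
          (\<exists>code :: 'a \<Rightarrow> bool list.
             (\<forall>x\<in>pverts G. real (length (code x)) \<le> c * log 2 (real n)) \<and>
             (\<forall>x\<in>pverts G. \<forall>y\<in>pverts G. x \<noteq> y \<longrightarrow>
                ((x, y) \<in> parcs G \<longleftrightarrow> f (code x) (code y)))))"

end

theory Submission
  imports Defs "HOL-Library.Nat_Bijection" "HOL-Library.Infinite_Set" "HOL-Combinatorics.Transposition"
begin

text \<open>
  Order the vertices of a chordal bipartite graph with parts \<open>A\<close>, \<open>B\<close> so that both the rows and
  the columns of the bipartite adjacency matrix are lexicographically sorted, the last entry being
  the most significant. Without long induced cycles such a matrix has no submatrix
  with rows \<open>1 1\<close> and \<open>1 0\<close>. Hence for \<open>b \<in> B\<close> the neighbourhoods of the neighbours of \<open>b\<close>,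
  restricted to the columns from \<open>b\<close> on, form a chain under inclusion. A long chain of distinct
  sets contains a large half graph and thus the chain graph \<open>H\<close>, so only boundedly many sets occur.
  As the rows are sorted, the neighbours of \<open>b\<close> with equal restricted neighbourhoods are
  consecutive in the row order. So the neighbourhood of \<open>b\<close> is a union of boundedly many
  intervals of rows: a row is encoded by its rank, a column by the end points of its intervals.
\<close>

subsection \<open>Induced subgraphs from embeddings\<close>

text \<open>The image of \<open>\<phi>\<close> induces the required subgraph \<open>K\<close>. Since
  \<open>digraph_iso K H\<close> maps from \<open>K\<close> to \<open>H\<close>, the isomorphism is
  built from the inverse \<open>g\<close> of \<open>\<phi>\<close>.\<close>

lemma not_free_ofI:
  assumes G: "pair_wf_digraph G" and H: "pair_wf_digraph H"
    and inj: "inj_on \<phi> (pverts H)" and sub: "\<phi> ` pverts H \<subseteq> pverts G"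
    and adj: "\<And>x y. x \<in> pverts H \<Longrightarrow> y \<in> pverts H \<Longrightarrow> (x, y) \<in> parcs H \<longleftrightarrow> (\<phi> x, \<phi> y) \<in> parcs G"
  shows "\<not> free_of H G"
proof -
  let ?W = "\<phi> ` pverts H"
  define K where "K = \<lparr>pverts = ?W, parcs = {e \<in> parcs G. fst e \<in> ?W \<and> snd e \<in> ?W}\<rparr>"
  define g where "g = inv_into (pverts H) \<phi>"
  have g: "g (\<phi> x) = x" if "x \<in> pverts H" for x
    using that inj by (simp add: g_def)
  have wfK: "wf_digraph (with_proj K)"
    unfolding wf_digraph_wp_iff by unfold_locales (auto simp: K_def)
  have "subgraph (with_proj K) (with_proj G)"
    using wfK G sub by (auto simp: subgraph_def wf_digraph_wp_iff) (auto simp: K_def)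
  then have ind: "induced_subgraph (with_proj K) (with_proj G)"
    by (simp add: induced_subgraph_def) (simp add: K_def)
  define f where "f = \<lparr>iso_verts = g, iso_arcs = map_prod g g, iso_head = snd, iso_tail = fst\<rparr>"
  have injg: "inj_on g ?W"
    by (rule inj_onI) (auto simp: g)
  have "pre_digraph.digraph_isomorphism (with_proj K) f"
    unfolding pre_digraph.digraph_isomorphism_def
  proof (intro conjI wfK)
    show "inj_on (iso_verts f) (verts (with_proj K))"
      using injg by (simp add: f_def K_def)
    have "inj_on (map_prod g g) (?W \<times> ?W)"
      using injg injg by (rule map_prod_inj_on)
    moreover have "parcs K \<subseteq> ?W \<times> ?W"
      by (auto simp: K_def)
    ultimately show "inj_on (iso_arcs f) (arcs (with_proj K))"
      by (simp add: f_def inj_on_subset)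
  qed (auto simp: f_def)
  moreover have "with_proj H = app_iso f (with_proj K)"
  proof -
    have 1: "g ` ?W = pverts H"
      by (force simp: g image_image)
    have 2: "map_prod g g ` parcs K = parcs H"
    proof (intro set_eqI iffI)
      fix e assume "e \<in> map_prod g g ` parcs K"
      then show "e \<in> parcs H"
        using adj by (auto simp: K_def g)
    next
      fix e assume e: "e \<in> parcs H"
      then have "fst e \<in> pverts H" "snd e \<in> pverts H"
        using pair_wf_digraph.arc_fst_in_verts[OF H] pair_wf_digraph.arc_snd_in_verts[OF H] by auto
      with e have "map_prod \<phi> \<phi> e \<in> parcs K" "e = map_prod g g (map_prod \<phi> \<phi> e)"
        using adj[of "fst e" "snd e"] by (auto simp: K_def g map_prod_def split_def)
      then show "e \<in> map_prod g g ` parcs K" by blast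
    qed
    show ?thesis
      using 1 2 by (simp add: app_iso_def f_def with_proj_def) (simp add: K_def)
  qed
  ultimately show ?thesis
    using ind unfolding free_of_def digraph_iso_def by blast
qed


subsection \<open>Doubly lexical rankings\<close>

definition lex_below :: "('a \<Rightarrow> nat) \<Rightarrow> 'a set \<Rightarrow> 'a set \<Rightarrow> 'a \<Rightarrow> bool" where
  "lex_below \<rho> S T c \<longleftrightarrow> c \<in> T - S \<and> (\<forall>d. \<rho> c < \<rho> d \<longrightarrow> (d \<in> S \<longleftrightarrow> d \<in> T))"

text \<open>Distinct ranks make the sums binary numbers. If the highest differing element lay in
  \<open>S\<close>, its power of two alone would exceed everything that \<open>T - S\<close> can
  contribute, contradicting the inequality.\<close>

lemma lex_below_if_sum_le:
  fixes \<rho> :: "'a \<Rightarrow> nat"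
  assumes fin: "finite S" "finite T" and inj: "inj_on \<rho> (S \<union> T)"
    and le: "(\<Sum>c\<in>S. 2 ^ \<rho> c) \<le> (\<Sum>c\<in>T. 2 ^ \<rho> c :: nat)" and "S \<noteq> T"
  shows "\<exists>c. lex_below \<rho> S T c"
proof -
  let ?D = "(S - T) \<union> (T - S)"
  have "finite (\<rho> ` ?D)" "\<rho> ` ?D \<noteq> {}"
    using assms by auto
  then have "Max (\<rho> ` ?D) \<in> \<rho> ` ?D"
    by (rule Max_in)
  then obtain c where c: "c \<in> ?D" "\<rho> c = Max (\<rho> ` ?D)"
    by (metis imageE)
  have top: "\<rho> d \<le> \<rho> c" if "d \<in> ?D" for d
    unfolding c(2) using that fin by (intro Max_ge) auto
  have "c \<in> T"
  proof (rule ccontr)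
    assume "c \<notin> T"
    with c have cS: "c \<in> S - T" by auto
    have lt: "\<rho> d < \<rho> c" if "d \<in> T - S" for d
    proof -
      have "\<rho> d \<noteq> \<rho> c"
        using inj that cS by (auto dest: inj_onD)
      then show ?thesis using top[of d] that by auto
    qed
    have "(\<Sum>d\<in>T - S. 2 ^ \<rho> d :: nat) = (\<Sum>i\<in>\<rho> ` (T - S). 2 ^ i)"
      by (rule sum.reindex_cong[symmetric, OF _ refl refl])
        (rule inj_on_subset[OF inj], auto)
    also have "\<dots> \<le> (\<Sum>i<\<rho> c. 2 ^ i)"
      by (rule sum_mono2) (auto simp: lt)
    also have "\<dots> < 2 ^ \<rho> c"
      by (simp add: lessThan_atLeast0 sum_power2)
    also have "\<dots> \<le> (\<Sum>d\<in>S - T. 2 ^ \<rho> d)"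
      using fin cS by (intro member_le_sum) auto
    finally have "(\<Sum>d\<in>T - S. 2 ^ \<rho> d :: nat) < (\<Sum>d\<in>S - T. 2 ^ \<rho> d)" .
    moreover have "(\<Sum>d\<in>S. 2 ^ \<rho> d :: nat) = (\<Sum>d\<in>S \<inter> T. 2 ^ \<rho> d) + (\<Sum>d\<in>S - T. 2 ^ \<rho> d)"
      using fin by (rule_tac sum.Int_Diff) auto
    moreover have "(\<Sum>d\<in>T. 2 ^ \<rho> d :: nat) = (\<Sum>d\<in>S \<inter> T. 2 ^ \<rho> d) + (\<Sum>d\<in>T - S. 2 ^ \<rho> d)"
      using sum.Int_Diff[OF fin(2), of "\<lambda>d. 2 ^ \<rho> d :: nat" S] by (simp add: Int_commute)
    ultimately show False using le by linarith
  qed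
  moreover have "d \<in> S \<longleftrightarrow> d \<in> T" if "\<rho> c < \<rho> d" for d
    using top[of d] that by auto
  ultimately show ?thesis
    using c unfolding lex_below_def by blast
qed

locale finite_bigraph =
  fixes E :: "'a \<Rightarrow> 'a \<Rightarrow> bool" and A B :: "'a set"
  assumes finA: "finite A" and finB: "finite B" and disj: "A \<inter> B = {}"
    and E_sym: "E x y \<Longrightarrow> E y x"
    and E_sides: "E x y \<Longrightarrow> x \<in> A \<and> y \<in> B \<or> x \<in> B \<and> y \<in> A"
begin

definition nb :: "'a \<Rightarrow> 'a set" where
  "nb x = {y. E x y}"

definition weight :: "('a \<Rightarrow> nat) \<Rightarrow> 'a \<Rightarrow> nat" where
  "weight \<rho> x = (\<Sum>y\<in>nb x. 2 ^ \<rho> y)"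

text \<open>
  The weight of a vertex is its row of the adjacency matrix read as a binary number. Swapping the
  ranks of \<open>x\<close> and \<open>y\<close> on one side changes the potential by
  \<open>(2 ^ \<rho> y - 2 ^ \<rho> x) * (weight x - weight y)\<close>, so a ranking of maximal potential sorts
  both sides lexicographically at the same time.
\<close>

definition potential :: "('a \<Rightarrow> nat) \<Rightarrow> nat" where
  "potential \<rho> = (\<Sum>x\<in>A. 2 ^ \<rho> x * weight \<rho> x)"

lemma flip: "finite_bigraph E B A"
  using finA finB disj E_sym E_sides by unfold_locales blast+

lemma nb_iff [simp]: "y \<in> nb x \<longleftrightarrow> E x y"
  by (simp add: nb_def)

lemma nb_sub: "nb x \<subseteq> A \<union> B"
  using E_sides by (auto simp: nb_def)

lemma E_A: "x \<in> A \<Longrightarrow> E x y \<Longrightarrow> y \<in> B"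
  using E_sides disj by blast

lemma E_B: "x \<in> B \<Longrightarrow> E x y \<Longrightarrow> y \<in> A"
  using E_sides disj by blast

lemma finite_nb [simp]: "finite (nb x)"
  using nb_sub finA finB by (meson finite_UnI finite_subset)

lemma potential_eq: "potential \<rho> = (\<Sum>x\<in>A. \<Sum>y | y \<in> B \<and> E x y. 2 ^ \<rho> x * 2 ^ \<rho> y)"
  unfolding potential_def weight_def sum_distrib_left
proof (rule sum.cong[OF refl])
  fix x assume "x \<in> A"
  then have "nb x = {y \<in> B. E x y}" using E_A by (auto simp: nb_def)
  then show "(\<Sum>y\<in>nb x. 2 ^ \<rho> x * 2 ^ \<rho> y) = (\<Sum>y | y \<in> B \<and> E x y. 2 ^ \<rho> x * 2 ^ \<rho> y :: nat)"
    by simp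
qed

text \<open>Every edge contributes the product of the powers at its two ends, which does not favour
  a part. This transfers \<open>potential_swap\<close> from \<open>A\<close> to
  \<open>B\<close>.\<close>

lemma potential_flip: "potential \<rho> = finite_bigraph.potential E B \<rho>"
proof -
  interpret f: finite_bigraph E B A by (rule flip)
  have E_iff: "E x y \<longleftrightarrow> E y x" for x y using E_sym by blast
  show ?thesis
    unfolding potential_eq f.potential_eq
    by (subst sum.swap_restrict[OF finA finB]) (simp add: E_iff mult.commute)
qed

text \<open>Weights of vertices in \<open>A\<close> read only ranks in \<open>B\<close>, so they
  survive the swap. Only the summands of \<open>x\<close> and \<open>y\<close> change, and pairing
  the larger power with the larger weight increases their sum.\<close>

lemma potential_swap:
  assumes xy: "x \<in> A" "y \<in> A" and lt: "\<rho> x < \<rho> y" and w: "weight \<rho> y < weight \<rho> x"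
  shows "potential \<rho> < potential (\<rho>(x := \<rho> y, y := \<rho> x))"
proof -
  let ?r = "\<rho>(x := \<rho> y, y := \<rho> x)"
  have we: "weight ?r a = weight \<rho> a" if "a \<in> A" for a
    unfolding weight_def using E_A[OF that] xy disj by (intro sum.cong) auto
  have xny: "x \<noteq> y" using lt by auto
  have split: "potential r = 2 ^ r x * weight r x + 2 ^ r y * weight r y
      + (\<Sum>a\<in>A - {x} - {y}. 2 ^ r a * weight r a)" for r
    unfolding potential_def using xy xny finA
    by (subst sum.remove[of A x], simp, simp) (subst sum.remove[of _ y], auto)
  have "(\<Sum>a\<in>A - {x} - {y}. 2 ^ ?r a * weight ?r a) = (\<Sum>a\<in>A - {x} - {y}. 2 ^ \<rho> a * weight \<rho> a)"
    by (intro sum.cong) (auto simp: we)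
  moreover have "2 ^ \<rho> x * weight \<rho> x + 2 ^ \<rho> y * weight \<rho> y
      < 2 ^ \<rho> y * weight \<rho> x + 2 ^ \<rho> x * weight \<rho> y"
  proof -
    obtain d where d: "weight \<rho> x = weight \<rho> y + d" "d > 0"
      using less_imp_add_positive[OF w] by metis
    have "(2::nat) ^ \<rho> x < 2 ^ \<rho> y"
      using lt by (intro power_strict_increasing) auto
    then have "(2::nat) ^ \<rho> x * d < 2 ^ \<rho> y * d"
      using d(2) by (intro mult_strict_right_mono)
    then show ?thesis
      unfolding d(1) distrib_left by linarith
  qed
  ultimately show ?thesis
    unfolding split[of \<rho>] split[of ?r] using xny xy by (simp add: we)
qed

definition doubly_lexical :: "('a \<Rightarrow> nat) \<Rightarrow> bool" where
  "doubly_lexical \<rho> \<longleftrightarrow> bij_betw \<rho> (A \<union> B) {..<card (A \<union> B)} \<and>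
     (\<forall>x y. (x \<in> A \<and> y \<in> A \<or> x \<in> B \<and> y \<in> B) \<and> \<rho> x < \<rho> y \<and> nb x \<noteq> nb y
        \<longrightarrow> (\<exists>c. lex_below \<rho> (nb x) (nb y) c))"

lemma ex_doubly_lexical: "\<exists>\<rho>. doubly_lexical \<rho>"
proof -
  let ?V = "A \<union> B"
  let ?n = "card ?V"
  let ?P = "\<lambda>\<rho>. bij_betw \<rho> ?V {..<?n}"
  interpret f: finite_bigraph E B A by (rule flip)
  obtain \<rho>0 where "?P \<rho>0"
    using ex_bij_betw_finite_nat[of ?V] finA finB by (auto simp: atLeast0LessThan)
  \<comment> \<open>The bound does not depend on \<open>\<rho>\<close>, so a maximiser exists among
    all rankings.\<close>
  moreover have "potential \<rho> < (\<Sum>x\<in>A. \<Sum>y | y \<in> B \<and> E x y. 2 ^ ?n * 2 ^ ?n) + 1" if "?P \<rho>" for \<rho>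
  proof -
    have "\<rho> x \<le> ?n" if "x \<in> ?V" for x
      using bij_betwE[OF \<open>?P \<rho>\<close>] that by (simp add: less_imp_le)
    then show ?thesis
      unfolding potential_eq less_Suc_eq_le Suc_eq_plus1[symmetric]
      by (intro sum_mono mult_mono power_increasing) auto
  qed
  ultimately obtain \<rho> where \<rho>: "?P \<rho>" and mx: "\<And>r. ?P r \<Longrightarrow> potential r \<le> potential \<rho>"
    using Lattices_Big.ex_has_greatest_nat[of ?P \<rho>0 potential] by blast
  have swap: "?P (\<rho>(x := \<rho> y, y := \<rho> x))" if "x \<in> ?V" "y \<in> ?V" for x y
  proof -
    have "bij_betw (\<rho> \<circ> Transposition.transpose x y) ?V {..<?n}"
      using that by (intro bij_betw_trans[OF _ \<rho>]) simp
    moreover have "\<rho> \<circ> Transposition.transpose x y = \<rho>(x := \<rho> y, y := \<rho> x)"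
      by (auto simp: fun_eq_iff Transposition.transpose_def)
    ultimately show ?thesis by simp
  qed
  have w: "weight \<rho> x \<le> weight \<rho> y" if sides: "x \<in> A \<and> y \<in> A \<or> x \<in> B \<and> y \<in> B" and lt: "\<rho> x < \<rho> y" for x y
  proof (rule ccontr)
    assume "\<not> weight \<rho> x \<le> weight \<rho> y"
    then have "weight \<rho> y < weight \<rho> x" by simp
    then have "potential \<rho> < potential (\<rho>(x := \<rho> y, y := \<rho> x))"
      using sides lt potential_swap[of x y \<rho>] f.potential_swap[of x y \<rho>]
      by (auto simp only: potential_flip)
    moreover have "?P (\<rho>(x := \<rho> y, y := \<rho> x))"
      using sides by (intro swap) auto
    ultimately show False
      using mx leD by blast
  qed
  have "\<exists>c. lex_below \<rho> (nb x) (nb y) c"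
    if "x \<in> A \<and> y \<in> A \<or> x \<in> B \<and> y \<in> B" "\<rho> x < \<rho> y" "nb x \<noteq> nb y" for x y
  proof (rule lex_below_if_sum_le)
    show "inj_on \<rho> (nb x \<union> nb y)"
      using bij_betw_imp_inj_on[OF \<rho>] nb_sub by (rule_tac inj_on_subset) auto
  qed (use w[OF that(1,2)] that(3) in \<open>auto simp only: weight_def finite_nb\<close>)
  with \<rho> show ?thesis
    unfolding doubly_lexical_def by blast
qed

end

subsection \<open>Absence of forbidden corners\<close>

text \<open>
  Two paths indexed by a Boolean. In the use below \<open>N\<close> is the neighbourhood function and \<open>t S T\<close>
  the vertex of highest rank in which \<open>S\<close> and \<open>T\<close> differ; the two paths then have no edges between
  them apart from the first and last rungs.
\<close>

fun zigzag :: "('a \<Rightarrow> 'a set) \<Rightarrow> ('a set \<Rightarrow> 'a set \<Rightarrow> 'a) \<Rightarrow> (bool \<Rightarrow> 'a) \<Rightarrow> (bool \<Rightarrow> 'a) \<Rightarrow> bool \<Rightarrow> nat \<Rightarrow> 'a"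
  where
    "zigzag N t x y s 0 = x s"
  | "zigzag N t x y s (Suc 0) = y s"
  | "zigzag N t x y s (Suc (Suc n)) = t (N (zigzag N t x y (\<not> s) n)) (N (zigzag N t x y s (Suc n)))"

context finite_bigraph
begin

definition long_induced_cycle :: "nat \<Rightarrow> (nat \<Rightarrow> 'a) \<Rightarrow> bool" where
  "long_induced_cycle k v \<longleftrightarrow> 6 \<le> k \<and> inj_on v {..<k} \<and>
     (\<forall>i<k. \<forall>j<k. E (v i) (v j) \<longleftrightarrow> j = (i + 1) mod k \<or> i = (j + 1) mod k)"

lemma not_same_side: "E x y \<Longrightarrow> \<not> (x \<in> A \<and> y \<in> A) \<and> \<not> (x \<in> B \<and> y \<in> B)"
  using E_sides disj by blast

text \<open>Going up the \<open>True\<close> path and back down the \<open>False\<close> path closes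
  a cycle through the rungs \<open>0\<close> and \<open>L\<close>. It has \<open>2 * L + 2\<close>
  vertices, hence at least 6.\<close>

lemma ladder_cycle:
  fixes Z :: "bool \<Rightarrow> nat \<Rightarrow> 'a"
  assumes L: "2 \<le> L"
    and adj: "\<And>s s' i j. i \<le> L \<Longrightarrow> j \<le> L \<Longrightarrow> E (Z s i) (Z s' j) \<longleftrightarrow>
      (if s = s' then j = i + 1 \<or> i = j + 1 else i = j \<and> (i = 0 \<or> i = L))"
    and inj: "\<And>s s' i j. i \<le> L \<Longrightarrow> j \<le> L \<Longrightarrow> Z s i = Z s' j \<Longrightarrow> s = s' \<and> i = j"
  shows "\<exists>k v. long_induced_cycle k v"
proof -
  define k where "k = 2 * L + 2"
  define v where "v i = (if i \<le> L then Z True i else Z False (2 * L + 1 - i))" for i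
  have inj_v: "inj_on v {..<k}"
  proof (rule inj_onI)
    fix i j assume *: "i \<in> {..<k}" "j \<in> {..<k}" "v i = v j"
    then have "2 * L + 1 - i \<le> L" if "\<not> i \<le> L" using that by auto
    moreover have "2 * L + 1 - j \<le> L" if "\<not> j \<le> L" using that by auto
    ultimately show "i = j"
      using *  inj[of i j True True] inj[of i "2 * L + 1 - j" True False]
        inj[of "2 * L + 1 - i" j False True] inj[of "2 * L + 1 - i" "2 * L + 1 - j" False False]
      by (auto simp: v_def k_def split: if_splits)
  qed
  have md: "(i + 1) mod k = (if i = 2 * L + 1 then 0 else i + 1)" if "i < k" for i
    using that by (auto simp: k_def)
  have "E (v i) (v j) \<longleftrightarrow> j = (i + 1) mod k \<or> i = (j + 1) mod k" if ij: "i < k" "j < k" for i j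
  proof -
    have i: "2 * L + 1 - i \<le> L \<and> i \<le> 2 * L + 1" if "\<not> i \<le> L" using that ij by (auto simp: k_def)
    have j: "2 * L + 1 - j \<le> L \<and> j \<le> 2 * L + 1" if "\<not> j \<le> L" using that ij by (auto simp: k_def)
    consider "i \<le> L" "j \<le> L" | "i \<le> L" "\<not> j \<le> L" | "\<not> i \<le> L" "j \<le> L" | "\<not> i \<le> L" "\<not> j \<le> L"
      by blast
    then show ?thesis
    proof cases
      case 1
      then show ?thesis unfolding md[OF ij(1)] md[OF ij(2)] by (simp add: v_def adj)
    next
      case 2
      with L j show ?thesis
        unfolding md[OF ij(1)] md[OF ij(2)] by (simp add: v_def adj) linarith
    next
      case 3
      with L i show ?thesis
        unfolding md[OF ij(1)] md[OF ij(2)] by (simp add: v_def adj) linarith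
    next
      case 4
      with L i j show ?thesis
        unfolding md[OF ij(1)] md[OF ij(2)] by (simp add: v_def adj) linarith
    qed
  qed
  with L inj_v have "long_induced_cycle k v"
    unfolding long_induced_cycle_def by (simp add: k_def)
  then show ?thesis by blast
qed

lemma gamma_free:
  assumes dl: "doubly_lexical \<rho>" and nocyc: "\<nexists>k v. long_induced_cycle k v"
    and sides: "a \<in> A" "a' \<in> A" "b \<in> B" "b' \<in> B"
    and lt: "\<rho> a < \<rho> a'" "\<rho> b < \<rho> b'"
    and E: "E a b" "E a b'" "E a' b"
  shows "E a' b'"
proof (rule ccontr)
  assume nE: "\<not> E a' b'"
  text \<open>
    The violated corner \<open>a, b, a', b'\<close> starts a ladder of two paths that climb in rank. Comparing
    two consecutive vertices of one side yields the next vertices, whose ranks force all chords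
    to be absent. As ranks are bounded, some rung must close the ladder to an induced cycle.
  \<close>
  let ?V = "A \<union> B"
  define top where "top S T = (SOME c. lex_below \<rho> S T c)" for S T
  define Z where "Z = zigzag nb top (\<lambda>s. if s then a else b) (\<lambda>s. if s then b' else a')"
  \<comment> \<open>The \<open>True\<close> path starts in \<open>A\<close>, the
    \<open>False\<close> path in \<open>B\<close>, and both alternate. So \<open>Z s n\<close>
    shares its part with \<open>Z (\<not> s) (Suc n)\<close>, which is why \<open>P\<close> compares
    ranks crosswise.\<close>
  define side where "side s n = (if s = even n then A else B)" for s and n :: nat
  define rung where "rung n = E (Z True n) (Z False n)" for n
  define P where "P n \<longleftrightarrow> (\<forall>s. E (Z s n) (Z s (Suc n)) \<and> \<rho> (Z s n) < \<rho> (Z (\<not> s) (Suc n))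
      \<and> Z s n \<in> side s n \<and> Z s (Suc n) \<in> side s (Suc n))" for n
  have Z: "Z True 0 = a" "Z False 0 = b" "Z True (Suc 0) = b'" "Z False (Suc 0) = a'"
    "Z s (Suc (Suc n)) = top (nb (Z (\<not> s) n)) (nb (Z s (Suc n)))" for s n
    by (simp_all add: Z_def)
  have inj: "inj_on \<rho> ?V" using dl by (simp add: doubly_lexical_def bij_betw_def)
  have sideV: "side s n \<subseteq> ?V" for s n by (auto simp: side_def)
  have side_flip: "side (\<not> s) (Suc n) = side s n" for s n by (auto simp: side_def)
  have rung': "E (Z s n) (Z (\<not> s) n) \<longleftrightarrow> rung n" for s n
    using E_sym by (cases s) (auto simp: rung_def)
  have opp: "y \<in> side s (Suc n)" if "E x y" "x \<in> side s n" for x y s n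
    using not_same_side[OF that(1)] E_sides[OF that(1)] that(2) disj by (auto simp: side_def split: if_splits)
  have same: "\<not> E x y" if "x \<in> side s n" "y \<in> side s n" for x y s n
    using that not_same_side[of x y] by (auto simp: side_def split: if_splits)
  have P0: "P 0"
    using sides lt E E_sym by (auto simp: P_def side_def Z split: bool.split)
  have P_lt: "\<rho> (Z (\<not> s) n) < \<rho> (Z s (Suc n))" if "P n" for s n
    using that[unfolded P_def, rule_format, of "\<not> s"] by simp
  \<comment> \<open>With rung \<open>Suc n\<close> absent, \<open>Z (\<not> s) (Suc n)\<close> is
    adjacent to the first vertex but not to the second. Their neighbourhoods differ, so the choice
    in \<open>top\<close> has a witness.\<close>
  have TD: "lex_below \<rho> (nb (Z (\<not> s) n)) (nb (Z s (Suc n))) (Z s (Suc (Suc n)))"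
    if "P n" "\<not> rung (Suc n)" for s n
  proof -
    have "\<rho> (Z (\<not> s) n) < \<rho> (Z s (Suc n))"
      using that(1) by (rule P_lt)
    moreover have "Z (\<not> s) n \<in> side (\<not> s) n" "Z s (Suc n) \<in> side (\<not> s) n"
      using that(1) side_flip[of "\<not> s" n] unfolding P_def by auto
    moreover have "Z (\<not> s) (Suc n) \<in> nb (Z (\<not> s) n)" "Z (\<not> s) (Suc n) \<notin> nb (Z s (Suc n))"
      using that rung' unfolding P_def by auto
    ultimately have "\<exists>c. lex_below \<rho> (nb (Z (\<not> s) n)) (nb (Z s (Suc n))) c"
      using dl unfolding doubly_lexical_def side_def by (metis (full_types))
    then show ?thesis
      unfolding Z top_def by (rule someI_ex)
  qed
  have step: "P (Suc n)" if "P n" "\<not> rung (Suc n)" for n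
    unfolding P_def
  proof (intro allI conjI)
    fix s
    show E1: "E (Z s (Suc n)) (Z s (Suc (Suc n)))" for s
      using TD[OF that, of s] by (simp add: lex_below_def)
    show V1: "Z s (Suc n) \<in> side s (Suc n)" for s
      using that(1) by (simp add: P_def)
    show V2: "Z s (Suc (Suc n)) \<in> side s (Suc (Suc n))" for s
      using opp[OF E1 V1] .
    let ?c = "Z (\<not> s) (Suc (Suc n))"
    have lb: "lex_below \<rho> (nb (Z s n)) (nb (Z (\<not> s) (Suc n))) ?c"
      using TD[OF that, of "\<not> s"] by simp
    \<comment> \<open>\<open>Z s (Suc n)\<close> is another place where these two neighbourhoods
      differ, and \<open>?c\<close> is the highest such place, so the rank must climb.\<close>
    have "Z s (Suc n) \<in> nb (Z s n)" "Z s (Suc n) \<notin> nb (Z (\<not> s) (Suc n))"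
      using that rung'[of "\<not> s" "Suc n"] unfolding P_def by auto
    then have "\<not> \<rho> ?c < \<rho> (Z s (Suc n))" "?c \<noteq> Z s (Suc n)"
      using lb by (auto simp: lex_below_def)
    moreover have "\<rho> ?c \<noteq> \<rho> (Z s (Suc n))"
      using \<open>?c \<noteq> _\<close> inj_onD[OF inj] V1[of s] V2[of "\<not> s"] sideV by blast
    ultimately show "\<rho> (Z s (Suc n)) < \<rho> ?c" by linarith
  qed
  have "\<exists>m. rung (Suc m)"
  proof (rule ccontr)
    assume "\<nexists>m. rung (Suc m)"
    then have P: "P n" for n by (induction n) (auto simp: P0 intro: step)
    have "n \<le> \<rho> (Z s n)" for s n
    proof (induction n arbitrary: s)
      case (Suc n)
      have "\<rho> (Z (\<not> s) n) < \<rho> (Z s (Suc n))"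
        using P by (rule P_lt)
      with Suc[of "\<not> s"] show ?case by linarith
    qed simp
    moreover have "\<rho> (Z True (card ?V)) < card ?V"
      using dl P[of "card ?V"] sideV[of True "card ?V"] unfolding doubly_lexical_def P_def
      by (meson bij_betwE lessThan_iff subsetD)
    ultimately show False by (meson not_le)
  qed
  then obtain m where m: "rung (Suc m)" "\<And>i. i < m \<Longrightarrow> \<not> rung (Suc i)"
    using exists_least_iff[of "\<lambda>m. rung (Suc m)"] by blast
  \<comment> \<open>Rung 1 would be the missing edge between \<open>a'\<close> and
    \<open>b'\<close>. Hence the first closing rung is at level 2 or later.\<close>
  have "m \<noteq> 0"
  proof
    assume "m = 0"
    with m(1) nE E_sym show False by (auto simp: rung_def Z)
  qed
  define L where "L = Suc m"
  have L: "2 \<le> L" using \<open>m \<noteq> 0\<close> by (simp add: L_def)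
  have P: "P n" if "n < L" for n
    using that by (induction n) (auto simp: P0 L_def m(2) intro!: step)
  have TDL: "lex_below \<rho> (nb (Z (\<not> s) n)) (nb (Z s (Suc n))) (Z s (Suc (Suc n)))"
    if "Suc n < L" for s n
    using that by (intro TD P m(2)) (auto simp: L_def)
  have inV: "Z s n \<in> side s n" if "n \<le> L" for s n
    using that P[of n] P[of "n - 1"] by (cases "n = L") (auto simp: P_def L_def)
  have E1: "E (Z s n) (Z s (Suc n))" if "n < L" for s n
    using P[OF that] by (simp add: P_def)
  \<comment> \<open>\<open>s = even e\<close> selects the path whose vertex at level
    \<open>n + e\<close> lies in the same part as \<open>Z s n\<close>.\<close>
  have mono: "\<rho> (Z s n) < \<rho> (Z (s = even e) (n + e))" if "n + e \<le> L" "e > 0" for s n e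
    using that
  proof (induction e)
    case (Suc e)
    have "\<rho> (Z s' (n + e)) < \<rho> (Z (\<not> s') (n + Suc e))" for s'
      using P[of "n + e"] Suc.prems by (auto simp: P_def)
    from this[of "s = even e"] Suc show ?case
      by (cases "e = 0") (auto dest: less_trans)
  qed simp
  \<comment> \<open>\<open>s = odd d\<close> selects the vertex of level \<open>i\<close> in the
    opposite part; the same-part case is settled by bipartiteness. For \<open>d = 2\<close> the
    witness lies outside the first neighbourhood. For larger \<open>d\<close> the vertex ranks above
    the witness separating levels \<open>i\<close> and \<open>i + 1\<close>, so a non-edge to level
    \<open>i + 1\<close> passes down to level \<open>i\<close>.\<close>
  have far: "\<not> E (Z s (i + d)) (Z (s = odd d) i)" if "2 \<le> d" "i + d \<le> L" for s i d
    using that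
  proof (induction d arbitrary: i rule: dec_induct)
    case base
    then show ?case
      using TDL[of i s] E_sym by (auto simp: lex_below_def)
  next
    case (step d)
    let ?r = "s = odd d" and ?z = "Z s (i + Suc d)"
    have "\<not> E ?z (Z ?r (Suc i))" using step.IH[of "Suc i"] step.prems by simp
    moreover have "\<rho> (Z ?r (i + 2)) < \<rho> ?z"
    proof -
      have "(?r = even (d - 1)) = s" using step.hyps by auto
      then show ?thesis using mono[of "i + 2" "d - 1" ?r] step by auto
    qed
    ultimately have "?z \<notin> nb (Z (\<not> ?r) i)"
      using TDL[of i ?r] step E_sym by (auto simp: lex_below_def)
    moreover have "(s = odd (Suc d)) = (\<not> ?r)" by auto
    ultimately show ?case using E_sym by auto
  qed
  have side_eq: "side s i = side s' j" if "(s = even i) = (s' = even j)" for s s' and i j :: nat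
    using that by (auto simp: side_def)
  have adj_less: "E (Z s i) (Z s' j) \<longleftrightarrow> s = s' \<and> j = i + 1" if "i < j" "j \<le> L" for s s' i j
  proof -
    define d where "d = j - i"
    have j: "j = i + d" "d > 0" using that by (auto simp: d_def)
    show ?thesis
    proof (cases "(s = s') = odd d")
      case True
      show ?thesis
      proof (cases "d = 1")
        case True
        with \<open>(s = s') = odd d\<close> j that show ?thesis using E1[of i s] by auto
      next
        case False
        with j have "2 \<le> d" by linarith
        moreover have "(s' = odd d) = s" using True by auto
        ultimately show ?thesis
          using far[of d i s'] that j E_sym by auto
      qed
    next
      case False
      have "side s i = side s' j" using False j by (intro side_eq) auto
      then have "\<not> E (Z s i) (Z s' j)"
        using same inV[of i s] inV[of j s'] that by auto
      with False j show ?thesis by auto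
    qed
  qed
  have adj_eq: "E (Z s i) (Z s' i) \<longleftrightarrow> s \<noteq> s' \<and> (i = 0 \<or> i = L)" if "i \<le> L" for s s' i
  proof (cases "s = s'")
    case True
    then show ?thesis using same[OF inV[OF that] inV[OF that]] by auto
  next
    case False
    then have "s' = (\<not> s)" by auto
    moreover have "rung i \<longleftrightarrow> i = 0 \<or> i = L"
    proof (cases i)
      case 0
      then show ?thesis using E(1) by (simp add: rung_def Z)
    next
      case (Suc k)
      then show ?thesis using m(1) m(2)[of k] that by (auto simp: L_def le_less)
    qed
    ultimately show ?thesis using rung' by auto
  qed
  have adj: "E (Z s i) (Z s' j) \<longleftrightarrow> (if s = s' then j = i + 1 \<or> i = j + 1 else i = j \<and> (i = 0 \<or> i = L))"
    if "i \<le> L" "j \<le> L" for s s' i j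
    using that adj_less[of i j s s'] adj_less[of j i s' s] adj_eq[of i s s'] E_sym
    by (cases i j rule: linorder_cases) auto
  have inj_less: "Z s i \<noteq> Z s' j" if "i < j" "j \<le> L" for s s' i j
  proof
    assume eq: "Z s i = Z s' j"
    define d where "d = j - i"
    have j: "j = i + d" "d > 0" using that by (auto simp: d_def)
    have "s' = (s = even d)"
      using inV[of i s] inV[of j s'] that eq disj j by (auto simp: side_def split: if_splits)
    then show False using mono[of i d s] that j eq by auto
  qed
  have inj_Z: "s = s' \<and> i = j" if "i \<le> L" "j \<le> L" "Z s i = Z s' j" for s s' i j
  proof -
    have "i = j" using inj_less[of i j s s'] inj_less[of j i s' s] that by (metis linorder_neqE_nat)
    moreover have "Z s i \<in> side s i" "Z s i \<in> side s' i"
      using inV[of i s] inV[of i s'] that(1,3) \<open>i = j\<close> by metis+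
    then have "s = s'"
      using disj unfolding side_def by (metis disjoint_iff)
    ultimately show ?thesis by simp
  qed
  have "\<exists>k v. long_induced_cycle k v"
    using L adj inj_Z by (rule ladder_cycle)
  with nocyc show False ..
qed

end

subsection \<open>Columns as unions of few intervals\<close>

text \<open>The indices of \<open>w\<close> start at 1 because \<open>M\<close> strictly increasing
  sets have only \<open>M - 1\<close> successive differences.\<close>

definition half_graph :: "('a \<Rightarrow> 'a \<Rightarrow> bool) \<Rightarrow> 'a set \<Rightarrow> 'a set \<Rightarrow> nat \<Rightarrow> (nat \<Rightarrow> 'a) \<Rightarrow> (nat \<Rightarrow> 'a) \<Rightarrow> bool" where
  "half_graph E A B M u w \<longleftrightarrow> u ` {..<M} \<subseteq> A \<and> w ` {1..<M} \<subseteq> B \<and>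
     (\<forall>i\<in>{..<M}. \<forall>j\<in>{1..<M}. E (u i) (w j) \<longleftrightarrow> j \<le> i)"

context finite_bigraph
begin

definition tail_nb :: "('a \<Rightarrow> nat) \<Rightarrow> 'a \<Rightarrow> 'a \<Rightarrow> 'a set" where
  "tail_nb \<rho> b a = {c \<in> nb a. \<rho> b \<le> \<rho> c}"

text \<open>For a column \<open>c\<close> above \<open>b\<close>, the edges \<open>a b\<close>,
  \<open>a c\<close> and \<open>a' b\<close> are three corners of a rectangle, and
  \<open>gamma_free\<close> supplies the fourth, \<open>a' c\<close>.\<close>

lemma tail_nb_mono:
  assumes dl: "doubly_lexical \<rho>" and nocyc: "\<nexists>k v. long_induced_cycle k v"
    and b: "b \<in> B" and aa': "a \<in> nb b" "a' \<in> nb b" "\<rho> a \<le> \<rho> a'"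
  shows "tail_nb \<rho> b a \<subseteq> tail_nb \<rho> b a'"
proof
  have sd: "a \<in> A" "a' \<in> A" using aa' b E_B by auto
  have inj: "inj_on \<rho> (A \<union> B)" using dl by (simp add: doubly_lexical_def bij_betw_def)
  fix c assume c: "c \<in> tail_nb \<rho> b a"
  then have cB: "c \<in> B" using sd E_A by (auto simp: tail_nb_def)
  have "E a' c"
  proof (cases "a = a' \<or> c = b")
    case True
    then show ?thesis using c aa' E_sym by (auto simp: tail_nb_def)
  next
    case False
    then have "\<rho> a < \<rho> a'" "\<rho> b < \<rho> c"
      using inj_onD[OF inj] sd b cB aa'(3) c unfolding tail_nb_def
      by (auto simp: order_less_le)
    then show ?thesis
      using gamma_free[OF dl nocyc, of a a' b c] sd b cB aa' c E_sym
      by (auto simp: tail_nb_def)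
  qed
  with c show "c \<in> tail_nb \<rho> b a'" by (simp add: tail_nb_def)
qed

text \<open>If \<open>y\<close> had a different tail, both lexicographic increases, from
  \<open>x\<close> to \<open>y\<close> and from \<open>y\<close> to \<open>z\<close>, would have
  witnesses at or above \<open>b\<close>. At the more significant one, \<open>x\<close> has entry 0
  and \<open>z\<close> has entry 1, so their tails differ. The witnesses cannot coincide, as
  \<open>y\<close> has entry 1 at the first and 0 at the second.\<close>

lemma tail_nb_convex:
  assumes dl: "doubly_lexical \<rho>"
    and sides: "x \<in> A" "y \<in> A" "z \<in> A" and le: "\<rho> x \<le> \<rho> y" "\<rho> y \<le> \<rho> z"
    and eq: "tail_nb \<rho> b x = tail_nb \<rho> b z"
  shows "tail_nb \<rho> b y = tail_nb \<rho> b x"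
proof (rule ccontr)
  assume ne: "tail_nb \<rho> b y \<noteq> tail_nb \<rho> b x"
  have inj: "inj_on \<rho> (A \<union> B)" using dl by (simp add: doubly_lexical_def bij_betw_def)
  have "x \<noteq> y" "y \<noteq> z" using ne eq by auto
  then have lt: "\<rho> x < \<rho> y" "\<rho> y < \<rho> z"
    using inj_onD[OF inj] sides le by (auto simp: order_less_le)
  have "nb x \<noteq> nb y" "nb y \<noteq> nb z"
    using ne eq by (auto simp: tail_nb_def simp del: nb_iff)
  then obtain c d where c: "lex_below \<rho> (nb x) (nb y) c" and d: "lex_below \<rho> (nb y) (nb z) d"
    using dl sides lt unfolding doubly_lexical_def by metis
  have "\<rho> b \<le> \<rho> c"
  proof (rule ccontr)
    assume "\<not> \<rho> b \<le> \<rho> c"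
    then have "tail_nb \<rho> b y = tail_nb \<rho> b x"
      using c by (auto simp: tail_nb_def lex_below_def)
    with ne show False ..
  qed
  moreover have "\<rho> b \<le> \<rho> d"
  proof (rule ccontr)
    assume "\<not> \<rho> b \<le> \<rho> d"
    then have "tail_nb \<rho> b y = tail_nb \<rho> b z"
      using d by (auto simp: tail_nb_def lex_below_def)
    with ne eq show False by simp
  qed
  moreover have xz: "E x e \<longleftrightarrow> E z e" if "\<rho> b \<le> \<rho> e" for e
    using eq that by (auto simp: tail_nb_def set_eq_iff)
  moreover have "c \<in> B" "d \<in> B"
    using c d sides E_A by (auto simp: lex_below_def)
  moreover have "\<rho> c = \<rho> d \<Longrightarrow> c \<in> B \<Longrightarrow> d \<in> B \<Longrightarrow> c = d"
    using inj_onD[OF inj] by blast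
  ultimately show False
    using c d by (cases "\<rho> c" "\<rho> d" rule: linorder_cases) (auto simp: lex_below_def)
qed

text \<open>Each distinct tail gives one interval, from the least to the greatest rank of the
  neighbours of \<open>b\<close> with this tail. By \<open>tail_nb_convex\<close> every row in
  between has the same tail.\<close>

lemma column_intervals:
  assumes dl: "doubly_lexical \<rho>" and b: "b \<in> B"
  shows "\<exists>I :: (nat \<times> nat) list. length I = card (tail_nb \<rho> b ` nb b)
    \<and> (\<forall>(l, h)\<in>set I. l < card (A \<union> B) \<and> h < card (A \<union> B))
    \<and> (\<forall>x\<in>A. E x b \<longleftrightarrow> (\<exists>(l, h)\<in>set I. l \<le> \<rho> x \<and> \<rho> x \<le> h))"
proof -
  let ?F = "tail_nb \<rho> b ` nb b"
  define C where "C T = {a \<in> nb b. tail_nb \<rho> b a = T}" for T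
  define bounds where "bounds T = (Min (\<rho> ` C T), Max (\<rho> ` C T))" for T
  have fin: "finite (C T)" for T unfolding C_def by (rule finite_subset[OF _ finite_nb]) auto
  have ends: "\<exists>x\<in>C T. \<exists>z\<in>C T. bounds T = (\<rho> x, \<rho> z)" if "T \<in> ?F" for T
  proof -
    have "C T \<noteq> {}" using that by (auto simp: C_def)
    then have "Min (\<rho> ` C T) \<in> \<rho> ` C T" "Max (\<rho> ` C T) \<in> \<rho> ` C T"
      using fin by (auto intro!: Min_in Max_in)
    then show ?thesis unfolding bounds_def by blast
  qed
  have nbA: "nb b \<subseteq> A" using b E_B by auto
  have CA: "C T \<subseteq> A" for T using nbA by (auto simp: C_def)
  obtain Ts where Ts: "set Ts = ?F" "distinct Ts"
    using finite_distinct_list[of ?F] by auto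
  let ?I = "map bounds Ts"
  have "length ?I = card ?F"
    using Ts distinct_card by fastforce
  moreover have "l < card (A \<union> B) \<and> h < card (A \<union> B)" if lh: "(l, h) \<in> set ?I" for l h
  proof -
    have "(l, h) \<in> bounds ` ?F" using lh Ts(1) by (simp only: set_map)
    then obtain T where "T \<in> ?F" "bounds T = (l, h)" by (metis imageE)
    then obtain x z where "x \<in> C T" "z \<in> C T" "l = \<rho> x" "h = \<rho> z"
      using ends[of T] by auto
    then have "x \<in> A" "z \<in> A" "l = \<rho> x" "h = \<rho> z" using CA by blast+
    then show ?thesis
      using dl unfolding doubly_lexical_def by (metis UnCI bij_betwE lessThan_iff)
  qed
  moreover have "E x b \<longleftrightarrow> (\<exists>(l, h)\<in>set ?I. l \<le> \<rho> x \<and> \<rho> x \<le> h)" if x: "x \<in> A" for x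
  proof
    assume "E x b"
    then have xb: "x \<in> nb b" using E_sym by auto
    then have "x \<in> C (tail_nb \<rho> b x)" by (simp add: C_def)
    then have "fst (bounds (tail_nb \<rho> b x)) \<le> \<rho> x" "\<rho> x \<le> snd (bounds (tail_nb \<rho> b x))"
      using fin by (auto simp: bounds_def)
    moreover have "bounds (tail_nb \<rho> b x) \<in> set ?I" using xb Ts by auto
    ultimately show "\<exists>(l, h)\<in>set ?I. l \<le> \<rho> x \<and> \<rho> x \<le> h"
      by (intro bexI[of _ "bounds (tail_nb \<rho> b x)"]) (auto simp: case_prod_beta)
  next
    assume "\<exists>(l, h)\<in>set ?I. l \<le> \<rho> x \<and> \<rho> x \<le> h"
    then obtain l h where lh: "(l, h) \<in> set ?I" "l \<le> \<rho> x" "\<rho> x \<le> h" by blast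
    have "(l, h) \<in> bounds ` ?F" using lh(1) Ts(1) by (simp only: set_map)
    then obtain T where T: "T \<in> ?F" "bounds T = (l, h)" by (metis imageE)
    obtain y z where yz: "y \<in> C T" "z \<in> C T" "bounds T = (\<rho> y, \<rho> z)"
      using ends[OF T(1)] by blast
    have "tail_nb \<rho> b x = tail_nb \<rho> b y"
      using yz T lh CA x by (intro tail_nb_convex[OF dl, of y x z]) (auto simp: C_def)
    \<comment> \<open>The tail starts at \<open>b\<close> inclusively, so sharing a tail with a
      neighbour of \<open>b\<close> forces adjacency to \<open>b\<close>.\<close>
    moreover have "b \<in> tail_nb \<rho> b y" using yz E_sym by (auto simp: C_def tail_nb_def)
    ultimately show "E x b" by (auto simp: tail_nb_def)
  qed
  ultimately show ?thesis
    by (intro exI[of _ ?I]) (auto simp del: set_map)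
qed

text \<open>The tails form a chain, so sorting them by cardinality sorts them by inclusion. Take
  \<open>u i\<close> with the \<open>i\<close>-th tail, and \<open>w j\<close> in the
  \<open>j\<close>-th tail but not in the one before.\<close>

lemma ex_half_graph:
  assumes dl: "doubly_lexical \<rho>" and nocyc: "\<nexists>k v. long_induced_cycle k v" and b: "b \<in> B"
  shows "\<exists>u w. half_graph E A B (card (tail_nb \<rho> b ` nb b)) u w"
proof -
  let ?T = "tail_nb \<rho> b"
  let ?F = "?T ` nb b"
  let ?M = "card ?F"
  have nbA: "nb b \<subseteq> A" using b E_B by auto
  have fin: "finite (?T a)" for a unfolding tail_nb_def by (rule finite_subset[OF _ finite_nb]) auto
  have chain: "?T a \<subseteq> ?T a' \<or> ?T a' \<subseteq> ?T a" if "a \<in> nb b" "a' \<in> nb b" for a a'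
    using tail_nb_mono[OF dl nocyc b] that by (meson nat_le_linear)
  have "inj_on card ?F"
  proof (rule inj_onI)
    fix X Y assume XY: "X \<in> ?F" "Y \<in> ?F" "card X = card Y"
    then obtain a a' where "a \<in> nb b" "X = ?T a" "a' \<in> nb b" "Y = ?T a'" by blast
    then show "X = Y"
      using chain[of a a'] card_subset_eq[OF fin] XY(3) by metis
  qed
  then have "card (card ` ?F) = ?M" by (rule card_image)
  then obtain h where h: "bij_betw h {..<?M} (card ` ?F)" "strict_mono_on {..<?M} h"
    using ex_bij_betw_strict_mono_card[of "card ` ?F"] by (metis finite_imageI finite_nb)
  have "\<forall>i\<in>{..<?M}. \<exists>a\<in>nb b. card (?T a) = h i"
  proof
    fix i assume "i \<in> {..<?M}"
    then have "h i \<in> card ` ?F" using bij_betwE[OF h(1)] by blast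
    then show "\<exists>a\<in>nb b. card (?T a) = h i" by auto
  qed
  then obtain u where u: "\<And>i. i < ?M \<Longrightarrow> u i \<in> nb b \<and> card (?T (u i)) = h i"
    by (metis lessThan_iff)
  have less: "?T (u i) \<subset> ?T (u j)" if "i < j" "j < ?M" for i j
  proof -
    have "card (?T (u i)) < card (?T (u j))"
      using h(2) that u by (simp add: strict_mono_on_def)
    then have "\<not> ?T (u j) \<subseteq> ?T (u i)"
      using card_mono[OF fin] leD by blast
    then show ?thesis using chain[of "u i" "u j"] u that by auto
  qed
  have "\<forall>i\<in>{1..<?M}. \<exists>c. c \<in> ?T (u i) - ?T (u (i - 1))"
  proof
    fix i assume "i \<in> {1..<?M}"
    then have "?T (u (i - 1)) \<subset> ?T (u i)" by (intro less) auto
    then show "\<exists>c. c \<in> ?T (u i) - ?T (u (i - 1))" by blast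
  qed
  then obtain w where w: "\<And>i. i \<in> {1..<?M} \<Longrightarrow> w i \<in> ?T (u i) - ?T (u (i - 1))"
    by metis
  have "E (u i) (w j) \<longleftrightarrow> j \<le> i" if ij: "i \<in> {..<?M}" "j \<in> {1..<?M}" for i j
  proof
    assume e: "E (u i) (w j)"
    show "j \<le> i"
    proof (rule ccontr)
      assume "\<not> j \<le> i"
      then have "i = j - 1 \<or> i < j - 1" by auto
      moreover have jM: "j - 1 < ?M" using ij by auto
      ultimately have "?T (u i) \<subseteq> ?T (u (j - 1))"
        using less[of i "j - 1"] jM by (auto simp only:)
      then have "w j \<notin> ?T (u i)" using w[OF ij(2)] by blast
      with e w[OF ij(2)] show False by (auto simp: tail_nb_def)
    qed
  next
    assume "j \<le> i"
    then have "?T (u j) \<subseteq> ?T (u i)" using less[of j i] ij by (cases "i = j") auto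
    with w[OF ij(2)] show "E (u i) (w j)" by (auto simp: tail_nb_def)
  qed
  moreover have "u ` {..<?M} \<subseteq> A" using u nbA by auto
  moreover have "w ` {1..<?M} \<subseteq> B"
  proof -
    have "w i \<in> B" if "i \<in> {1..<?M}" for i
    proof -
      have "u i \<in> A" "w i \<in> nb (u i)" using u[of i] nbA w[OF that] that by (auto simp: tail_nb_def)
      then show ?thesis using E_A by simp
    qed
    then show ?thesis by blast
  qed
  ultimately show ?thesis unfolding half_graph_def by blast
qed

end

section \<open>Chain graphs as induced subgraphs of half graphs\<close>

text \<open>Adjacency in a chain graph is a threshold condition: \<open>x\<close> sees
  \<open>y\<close> iff the position of \<open>x\<close> in the order is at least the first position
  seeing \<open>y\<close>. A half graph realises such comparisons of indices. The bound
  \<open>M\<close> depends on \<open>H\<close> alone.\<close>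

lemma chain_graph_in_half_graph:
  fixes H :: "'b pair_pre_digraph"
  assumes "chain_graph H"
  shows "\<exists>M. \<forall>(G :: 'a pair_pre_digraph) A B m u w.
    pair_graph G \<and> bipartition G A B \<and> M \<le> m \<and> half_graph (\<lambda>x y. (x, y) \<in> parcs G) A B m u w
    \<longrightarrow> \<not> free_of H G"
proof -
  obtain A' B' xs where H: "pair_graph H" and bip: "bipartition H A' B'" and xs: "distinct xs" "set xs = A'"
    and sorted: "sorted_wrt (\<lambda>x y. neighbourhood H x \<subseteq> neighbourhood H y) xs"
    using assms unfolding chain_graph_def by blast
  interpret H: pair_graph H by fact
  define p where "p = length xs"
  define q where "q = card B'"
  define M where "M = (p + 1) * (q + 1)"
  have AB': "A' \<union> B' = pverts H" "A' \<inter> B' = {}"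
    and sidesH: "\<And>x y. (x, y) \<in> parcs H \<Longrightarrow> x \<in> A' \<and> y \<in> B' \<or> x \<in> B' \<and> y \<in> A'"
    using bip unfolding bipartition_def by auto
  have symH: "(x, y) \<in> parcs H \<longleftrightarrow> (y, x) \<in> parcs H" for x y
    using H.arcs_symmetric by blast
  have "finite B'" using AB' H.pair_finite_verts by (metis finite_Un)
  then obtain g where g: "bij_betw g B' {0..<q}"
    using ex_bij_betw_finite_nat q_def by blast
  have gq: "g y < q" if "y \<in> B'" for y using bij_betwE[OF g] that by auto
  have ex_f: "\<forall>x\<in>A'. \<exists>i. i < p \<and> xs ! i = x"
    using xs(2) unfolding p_def by (auto simp: in_set_conv_nth)
  obtain f where f: "\<And>x. x \<in> A' \<Longrightarrow> f x < p \<and> xs ! f x = x"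
    using bchoice[OF ex_f] by blast
  txt \<open>\<open>t y\<close> is the first neighbour of \<open>y\<close> in \<open>xs\<close>, and \<open>p\<close> if there is none.\<close>
  define t where "t y = (LEAST i. i = p \<or> (xs ! i, y) \<in> parcs H)" for y
  have tp: "t y \<le> p" for y unfolding t_def by (rule Least_le) simp
  have mono: "(xs ! j, y) \<in> parcs H" if "(xs ! i, y) \<in> parcs H" "i \<le> j" "j < p" for i j y
    using that sorted_wrt_nth_less[OF sorted, of i j]
    by (cases "i = j") (auto simp: neighbourhood_def p_def)
  have adjH: "(x, y) \<in> parcs H \<longleftrightarrow> t y \<le> f x" if "x \<in> A'" for x y
  proof
    assume "(x, y) \<in> parcs H"
    then show "t y \<le> f x" unfolding t_def using f[OF that] by (intro Least_le) auto
  next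
    assume le: "t y \<le> f x"
    have "t y = p \<or> (xs ! t y, y) \<in> parcs H"
      unfolding t_def by (rule LeastI[of _ p]) simp
    then show "(x, y) \<in> parcs H"
      using le f[OF that] mono[of "t y" y "f x"] by auto
  qed
  show ?thesis
  proof (intro exI[of _ M] allI impI, elim conjE)
    fix G :: "'a pair_pre_digraph" and A B m u w
    assume G: "pair_graph G" "bipartition G A B" and "M \<le> m"
      and hg: "half_graph (\<lambda>x y. (x, y) \<in> parcs G) A B m u w"
    interpret G: pair_graph G by fact
    have AB: "A \<union> B = pverts G" "A \<inter> B = {}"
      and sides: "\<And>x y. (x, y) \<in> parcs G \<Longrightarrow> x \<in> A \<and> y \<in> B \<or> x \<in> B \<and> y \<in> A"
      using G(2) unfolding bipartition_def by auto
    have symG: "(x, y) \<in> parcs G \<longleftrightarrow> (y, x) \<in> parcs G" for x y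
      using G.arcs_symmetric by blast
    have uA: "u i \<in> A" if "i < M" for i using hg that \<open>M \<le> m\<close> by (auto simp: half_graph_def)
    have wB: "w i \<in> B" if "1 \<le> i" "i < M" for i using hg that \<open>M \<le> m\<close> by (auto simp: half_graph_def)
    have uw: "(u i, w j) \<in> parcs G \<longleftrightarrow> j \<le> i" if "i < M" "1 \<le> j" "j < M" for i j
      using hg that \<open>M \<le> m\<close> unfolding half_graph_def by auto
    have u_inj: "i = j" if "u i = u j" "i < M" "j < M" for i j
      using uw[of i j] uw[of j i] uw[of i i] uw[of j j] that
      by (cases i j rule: linorder_cases) auto
    have w_inj: "i = j" if "w i = w j" "1 \<le> i" "1 \<le> j" "i < M" "j < M" for i j
      using uw[of i j] uw[of j i] uw[of i i] uw[of j j] that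
      by (cases i j rule: linorder_cases) auto
    txt \<open>Blocks of length \<open>q + 1\<close> leave room for up to \<open>q\<close> vertices of \<open>B'\<close> with equal neighbourhoods.\<close>
    define iu where "iu x = (f x + 1) * (q + 1)" for x
    define iw where "iw y = t y * (q + 1) + g y + 1" for y
    have iu: "iu x < M" if "x \<in> A'" for x
    proof -
      have "iu x \<le> p * (q + 1)" unfolding iu_def using f[OF that] by (intro mult_right_mono) auto
      then show ?thesis by (simp add: M_def)
    qed
    have iw: "1 \<le> iw y" "iw y < M" if "y \<in> B'" for y
    proof -
      have "t y * (q + 1) \<le> p * (q + 1)" using tp by (intro mult_right_mono) auto
      then show "iw y < M" using gq[OF that] by (simp add: M_def iw_def)
    qed (simp add: iw_def)
    \<comment> \<open>As \<open>g y + 1\<close> lies between 1 and \<open>q\<close>,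
      \<open>iw y\<close> is strictly inside block \<open>t y\<close>, while \<open>iu x\<close> is
      a block boundary.\<close>
    have iuw: "iw y \<le> iu x \<longleftrightarrow> t y \<le> f x" if "y \<in> B'" for x y
    proof
      assume "t y \<le> f x"
      then have "(t y + 1) * (q + 1) \<le> iu x" unfolding iu_def by (intro mult_right_mono) auto
      then show "iw y \<le> iu x" using gq[OF that] by (simp add: iw_def)
    next
      assume le: "iw y \<le> iu x"
      show "t y \<le> f x"
      proof (rule ccontr)
        assume "\<not> t y \<le> f x"
        then have "iu x \<le> t y * (q + 1)" unfolding iu_def by (intro mult_right_mono) auto
        with le show False by (simp add: iw_def)
      qed
    qed
    define \<phi> where "\<phi> x = (if x \<in> A' then u (iu x) else w (iw x))" for x
    have \<phi>A: "\<phi> x \<in> A" if "x \<in> A'" for x using that uA iu by (simp add: \<phi>_def)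
    have \<phi>B: "\<phi> x \<in> B" if "x \<in> B'" for x using that AB' wB iw by (auto simp: \<phi>_def)
    have \<phi>A_iff: "\<phi> x \<in> A \<longleftrightarrow> x \<in> A'" if "x \<in> pverts H" for x
      using that \<phi>A[of x] \<phi>B[of x] AB(2) AB'(1) by (metis Un_iff disjoint_iff)
    have "inj_on \<phi> (pverts H)"
    proof (rule inj_onI)
      fix x y assume xy: "x \<in> pverts H" "y \<in> pverts H" "\<phi> x = \<phi> y"
      then have "x \<in> A' \<longleftrightarrow> y \<in> A'"
        using \<phi>A_iff by metis
      then consider "x \<in> A'" "y \<in> A'" | "x \<in> B'" "y \<in> B'"
        using xy(1,2) AB'(1) by blast
      then show "x = y"
      proof cases
        case 1
        then have "iu x = iu y" using xy u_inj iu by (simp add: \<phi>_def)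
        then have "f x = f y" unfolding iu_def by (simp only: mult_cancel2) simp
        then show ?thesis using f 1 by metis
      next
        case 2
        then have "x \<notin> A'" "y \<notin> A'" using AB' by auto
        then have eq: "iw x = iw y" using xy w_inj iw 2 by (simp add: \<phi>_def)
        \<comment> \<open>The remainder modulo \<open>q + 1\<close> recovers \<open>g\<close>, which
          separates vertices of \<open>B'\<close> within a block.\<close>
        have "iw x - 1 = g x + t x * (q + 1)" "iw y - 1 = g y + t y * (q + 1)" by (simp_all add: iw_def)
        then have "(g x + t x * (q + 1)) mod (q + 1) = (g y + t y * (q + 1)) mod (q + 1)"
          using eq by simp
        then have "g x = g y"
          unfolding mod_mult_self1 using gq[of x] gq[of y] 2 by simp
        then show ?thesis using g 2 by (meson bij_betw_imp_inj_on inj_onD)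
      qed
    qed
    moreover have "\<phi> ` pverts H \<subseteq> pverts G"
      using \<phi>A \<phi>B AB AB' by blast
    moreover have "(x, y) \<in> parcs H \<longleftrightarrow> (\<phi> x, \<phi> y) \<in> parcs G" if "x \<in> pverts H" "y \<in> pverts H" for x y
    proof -
      have cross: "(x, y) \<in> parcs H \<longleftrightarrow> (\<phi> x, \<phi> y) \<in> parcs G" if "x \<in> A'" "y \<in> B'" for x y
      proof -
        have "y \<notin> A'" using that AB' by auto
        then show ?thesis
          using adjH[OF that(1)] uw[OF iu[OF that(1)] iw[OF that(2)]] iuw[OF that(2)] that(1)
          by (simp add: \<phi>_def)
      qed
      have "x \<in> A' \<or> x \<in> B'" "y \<in> A' \<or> y \<in> B'" using that unfolding AB'(1)[symmetric] by auto
      then consider "x \<in> A'" "y \<in> B'" | "x \<in> B'" "y \<in> A'" | "x \<in> A'" "y \<in> A'" | "x \<in> B'" "y \<in> B'"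
        by blast
      then show ?thesis
      proof cases
        case 1
        then show ?thesis by (rule cross)
      next
        case 2
        then show ?thesis using cross[of y x] symH[of x y] symG[of "\<phi> x" "\<phi> y"] by simp
      next
        case 3
        then have "(x, y) \<notin> parcs H" "(\<phi> x, \<phi> y) \<notin> parcs G"
          using sidesH[of x y] sides[of "\<phi> x" "\<phi> y"] \<phi>A[of x] \<phi>A[of y] AB(2) AB'(2)
          by (meson disjoint_iff)+
        then show ?thesis by simp
      next
        case 4
        then have "(x, y) \<notin> parcs H" "(\<phi> x, \<phi> y) \<notin> parcs G"
          using sidesH[of x y] sides[of "\<phi> x" "\<phi> y"] \<phi>B[of x] \<phi>B[of y] AB(2) AB'(2)
          by (meson disjoint_iff)+
        then show ?thesis by simp
      qed
    qed
    ultimately show "\<not> free_of H G"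
      using G.pair_wf_digraph_axioms H.pair_wf_digraph_axioms by (intro not_free_ofI)
  qed
qed

subsection \<open>Binary codes\<close>

fun bits :: "nat \<Rightarrow> bool list" where
  "bits n = (if n = 0 then [] else odd n # bits (n div 2))"

declare bits.simps [simp del]

lemma inj_bits: "inj bits"
proof (rule injI)
  fix m n
  show "bits m = bits n \<Longrightarrow> m = n"
  proof (induction m arbitrary: n rule: less_induct)
    case (less m)
    show ?case
    proof (cases "m = 0 \<or> n = 0")
      case True
      then show ?thesis
        using less.prems by (subst (asm) (1 2) bits.simps) (auto split: if_splits)
    next
      case False
      then have eq: "odd m = odd n" "bits (m div 2) = bits (n div 2)"
        using less.prems by (subst (asm) (1 2) bits.simps, simp)+
      then have "m div 2 = n div 2" using less.IH False by simp
      moreover have "m mod 2 = n mod 2" using eq(1) by (simp add: mod2_eq_if)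
      ultimately show ?thesis by (metis div_mult_mod_eq)
    qed
  qed
qed

lemma length_bits: "n < 2 ^ k \<Longrightarrow> length (bits n) \<le> k"
proof (induction k arbitrary: n)
  case (Suc k)
  then show ?case
    by (subst bits.simps) auto
qed (simp add: bits.simps)

lemma prod_encode_less: "prod_encode (a, b) < (a + b + 1) * (a + b + 1)"
proof -
  have "prod_encode (a, b) \<le> (a + b) * Suc (a + b) + (a + b)"
    unfolding prod_encode_def triangle_def by (auto intro!: add_mono div_le_dividend)
  also have "\<dots> < (a + b + 1) * (a + b + 1)" by (simp add: algebra_simps)
  finally show ?thesis .
qed

text \<open>Pairing is quadratic: an entry takes a bound \<open>s\<close> to at most
  \<open>4 * (s * s)\<close>, below \<open>s ^ 4\<close>. So the exponent grows by a factor 4 per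
  entry, and lists of bounded length stay polynomial in \<open>N\<close>.\<close>

lemma list_encode_less:
  assumes "3 \<le> N" "\<forall>x\<in>set xs. x \<le> N"
  shows "list_encode xs < N ^ (4 ^ length xs)"
  using assms(2)
proof (induction xs)
  case Nil
  then show ?case using assms(1) by simp
next
  case (Cons x xs)
  define e where "e = (4::nat) ^ length xs"
  define s where "s = N ^ e"
  have "N \<le> s" unfolding s_def using assms(1) by (intro self_le_power) (auto simp: e_def)
  moreover have "list_encode xs < s" "x \<le> N" using Cons by (auto simp: s_def e_def)
  ultimately have a: "x + list_encode xs + 1 \<le> 2 * s" and s: "3 \<le> s"
    using assms(1) by auto
  let ?t = "x + list_encode xs"
  have "prod_encode (x, list_encode xs) < (?t + 1) * (?t + 1)" by (rule prod_encode_less)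
  also have "\<dots> \<le> (2 * s) * (2 * s)" using a by (intro mult_mono) auto
  finally have "list_encode (x # xs) \<le> 4 * (s * s)" by simp
  also have "\<dots> < (3 * 3) * (s * s)" using s by simp
  also have "\<dots> \<le> (s * s) * (s * s)" using s by (intro mult_mono) auto
  also have "\<dots> = N ^ (4 ^ length (x # xs))"
  proof -
    have "4 ^ length (x # xs) = e + e + (e + e)" by (simp add: e_def)
    then show ?thesis by (simp only: s_def power_add)
  qed
  finally show ?case .
qed

text \<open>The entry bound \<open>4 * (n * n)\<close> accommodates encoded pairs of ranks and is at
  most \<open>n ^ 4\<close>. The \<open>+ 1\<close> in the constant absorbs the rounding up, since
  \<open>log 2 n\<close> is at least 1.\<close>

lemma length_bits_list_encode:
  assumes n: "2 \<le> n" and xs: "\<forall>x\<in>set xs. x < 4 * (n * n)" and len: "length xs \<le> L"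
  shows "real (length (bits (list_encode xs))) \<le> (4 * 4 ^ L + 1) * log 2 (real n)"
proof -
  have nn: "2 * 2 \<le> n * n" using n by (intro mult_mono) auto
  then have "(2 * 2) * (n * n) \<le> (n * n) * (n * n)" by (intro mult_right_mono) auto
  then have N: "4 * (n * n) \<le> n ^ 4" by (simp add: power4_eq_xxxx mult.assoc)
  have "3 \<le> n ^ 4" using N nn by linarith
  then have "list_encode xs < (n ^ 4) ^ (4 ^ length xs)"
    using xs N by (intro list_encode_less) auto
  also have "\<dots> \<le> (n ^ 4) ^ (4 ^ L)" using n len by (intro power_increasing) auto
  finally have lt: "list_encode xs < n ^ (4 * 4 ^ L)" by (simp add: power_mult)
  define k where "k = nat \<lceil>(4 * 4 ^ L) * log 2 (real n)\<rceil>"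
  have lg: "1 \<le> log 2 (real n)" using n by simp
  have kge: "(4 * 4 ^ L) * log 2 (real n) \<le> real k" unfolding k_def by linarith
  have "log 2 (real n ^ (4 * 4 ^ L)) \<le> real k"
    using kge n by (simp add: log_nat_power)
  then have "real n ^ (4 * 4 ^ L) \<le> 2 powr real k"
    using n by (subst (asm) log_le_iff) auto
  then have "real (n ^ (4 * 4 ^ L)) \<le> real (2 ^ k)"
    by (simp add: powr_realpow)
  then have "n ^ (4 * 4 ^ L) \<le> 2 ^ k" by (simp only: of_nat_le_iff)
  then have "length (bits (list_encode xs)) \<le> k" using lt by (intro length_bits) linarith
  moreover have "real k \<le> (4 * 4 ^ L) * log 2 (real n) + 1"
    unfolding k_def using lg by simp
  ultimately show ?thesis using lg by (simp add: algebra_simps)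
qed

section \<open>Assembling the implicit representation\<close>

lemma chordal_bipartite_no_long_cycle:
  assumes "chordal_bipartite G" "finite_bigraph (\<lambda>x y. (x, y) \<in> parcs G) A B"
  shows "\<nexists>k v. finite_bigraph.long_induced_cycle (\<lambda>x y. (x, y) \<in> parcs G) k v"
proof (intro notI, elim exE)
  fix k v
  interpret bg: finite_bigraph "\<lambda>x y. (x, y) \<in> parcs G" A B by fact
  interpret G: pair_graph G
    using assms(1) by (simp add: chordal_bipartite_def bipartite_graph_def)
  assume cyc: "bg.long_induced_cycle k v"
  then have k: "6 \<le> k" and inj: "inj_on v {..<k}"
    and adj: "\<And>i j. i < k \<Longrightarrow> j < k \<Longrightarrow> (v i, v j) \<in> parcs G \<longleftrightarrow> j = (i + 1) mod k \<or> i = (j + 1) mod k"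
    by (auto simp: bg.long_induced_cycle_def)
  have "v i \<in> pverts G" if "i < k" for i
  proof -
    have "(v i, v ((i + 1) mod k)) \<in> parcs G" using adj[OF that, of "(i + 1) mod k"] k by simp
    then show ?thesis by (rule G.in_arcsD1)
  qed
  moreover have "pair_wf_digraph (cycle_graph k)"
    by unfold_locales (auto simp: cycle_graph_def)
  ultimately have "\<not> free_of (cycle_graph k) G"
    using G.pair_wf_digraph_axioms inj adj by (intro not_free_ofI[where \<phi> = v]) (auto simp: cycle_graph_def)
  with assms(1) k show False by (simp add: chordal_bipartite_def)
qed

definition encode :: "nat list \<Rightarrow> bool list" where
  "encode xs = bits (list_encode xs)"

lemma encode_eq_iff [simp]: "encode xs = encode ys \<longleftrightarrow> xs = ys"
  unfolding encode_def using inj_bits by (simp add: inj_eq list_encode_eq)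

text \<open>The leading 0 or 1 tells row words from column words. The existential acts as the
  decoder, unambiguous because \<open>encode\<close> is injective, so the predicate depends only on
  the two codes.\<close>

definition row_in_column :: "bool list \<Rightarrow> bool list \<Rightarrow> bool" where
  "row_in_column s t \<longleftrightarrow> (\<exists>r I. s = encode [0, r] \<and> t = encode (1 # map prod_encode I)
     \<and> (\<exists>(l, h)\<in>set I. l \<le> r \<and> r \<le> h))"

theorem theorem15:
  fixes H :: "'b pair_pre_digraph"
  assumes "chain_graph H"
  shows "admits_implicit_representation
           {G :: 'a pair_pre_digraph. chordal_bipartite G \<and> free_of H G}"
proof -
  obtain M where M: "\<And>(G :: 'a pair_pre_digraph) A B m u w. pair_graph G \<Longrightarrow> bipartition G A B \<Longrightarrow> M \<le> m
      \<Longrightarrow> half_graph (\<lambda>x y. (x, y) \<in> parcs G) A B m u w \<Longrightarrow> \<not> free_of H G"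
    using chain_graph_in_half_graph[OF assms, where 'a = 'a] by blast
  \<comment> \<open>Row words have length 2 and column words at most \<open>M + 1\<close>; this
    covers both even for \<open>M = 0\<close>.\<close>
  define L where "L = M + 2"
  define c :: real where "c = 4 * 4 ^ L + 1"
  \<comment> \<open>Either argument may be the row, so both orders are tried.\<close>
  define f where "f s t \<longleftrightarrow> row_in_column s t \<or> row_in_column t s" for s t
  show ?thesis
    unfolding admits_implicit_representation_def
  proof (intro exI[of _ c] exI[of _ f] allI ballI impI)
    fix n :: nat and G :: "'a pair_pre_digraph"
    assume n: "2 \<le> n" and G: "G \<in> {G. chordal_bipartite G \<and> free_of H G}" and card: "card (pverts G) = n"
    then have cb: "chordal_bipartite G" and free: "free_of H G" by auto
    obtain A B where pg: "pair_graph G" and bip: "bipartition G A B"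
      using cb by (auto simp: chordal_bipartite_def bipartite_graph_def)
    interpret G: pair_graph G by fact
    have V: "A \<union> B = pverts G" and disj: "A \<inter> B = {}"
      using bip by (auto simp: bipartition_def)
    define E where "E = (\<lambda>x y. (x, y) \<in> parcs G)"
    interpret bg: finite_bigraph E A B
    proof
      show "finite A" "finite B" using V G.pair_finite_verts by (metis finite_Un)+
      show "E x y \<Longrightarrow> E y x" for x y unfolding E_def using G.arcs_symmetric by blast
      show "E x y \<Longrightarrow> x \<in> A \<and> y \<in> B \<or> x \<in> B \<and> y \<in> A" for x y
        using bip by (auto simp: E_def bipartition_def)
    qed (rule disj)
    have nocyc: "\<nexists>k v. bg.long_induced_cycle k v"
      using chordal_bipartite_no_long_cycle[OF cb] bg.finite_bigraph_axioms unfolding E_def by blast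
    obtain \<rho> where dl: "bg.doubly_lexical \<rho>" using bg.ex_doubly_lexical by blast
    \<comment> \<open>More than \<open>M\<close> tails would give a half graph large enough to
      contain \<open>H\<close>, contrary to \<open>free\<close>.\<close>
    have few: "card (bg.tail_nb \<rho> b ` bg.nb b) \<le> M" if "b \<in> B" for b
      using bg.ex_half_graph[OF dl nocyc that] M[OF pg bip] free unfolding E_def
      by (meson nat_le_linear)
    have "\<forall>b\<in>B. \<exists>I :: (nat \<times> nat) list. length I \<le> M \<and> (\<forall>(l, h)\<in>set I. l < n \<and> h < n)
        \<and> (\<forall>x\<in>A. E x b \<longleftrightarrow> (\<exists>(l, h)\<in>set I. l \<le> \<rho> x \<and> \<rho> x \<le> h))"
      using bg.column_intervals[OF dl] few unfolding V card by metis
    then obtain I :: "'a \<Rightarrow> (nat \<times> nat) list" where I: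
        "\<And>b. b \<in> B \<Longrightarrow> length (I b) \<le> M"
        "\<And>b l h. b \<in> B \<Longrightarrow> (l, h) \<in> set (I b) \<Longrightarrow> l < n \<and> h < n"
        "\<And>b x. b \<in> B \<Longrightarrow> x \<in> A \<Longrightarrow> E x b \<longleftrightarrow> (\<exists>(l, h)\<in>set (I b). l \<le> \<rho> x \<and> \<rho> x \<le> h)"
      by (auto dest!: bchoice) blast
    define word where "word x = (if x \<in> A then [0, \<rho> x] else 1 # map prod_encode (I x))" for x
    have small: "z < 4 * (n * n)" if "z < 2 \<or> z < n" for z
    proof -
      have "1 * n \<le> n * n" using n by (intro mult_right_mono) auto
      then show ?thesis using that n by linarith
    qed
    have len: "real (length (encode (word x))) \<le> c * log 2 (real n)" if x: "x \<in> pverts G" for x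
      unfolding encode_def c_def
    proof (rule length_bits_list_encode[OF n])
      show "length (word x) \<le> L"
        using I(1)[of x] x V by (auto simp: word_def L_def)
      show "\<forall>z\<in>set (word x). z < 4 * (n * n)"
      proof (cases "x \<in> A")
        case True
        have "bij_betw \<rho> (pverts G) {..<n}"
          using dl unfolding bg.doubly_lexical_def V card by simp
        then have "\<rho> x < n" using bij_betwE x by blast
        with True show ?thesis using small by (simp add: word_def)
      next
        case False
        have "prod_encode (l, h) < 4 * (n * n)" if "(l, h) \<in> set (I x)" for l h
        proof -
          have "l + h + 1 \<le> 2 * n" using I(2)[of x l h] that False x V by auto
          then have "(l + h + 1) * (l + h + 1) \<le> (2 * n) * (2 * n)" by (intro mult_mono) auto
          then show ?thesis using prod_encode_less[of l h] by simp
        qed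
        with False show ?thesis using small[of 1] by (auto simp: word_def)
      qed
    qed
    have row: "row_in_column (encode (word x)) (encode (word y)) \<longleftrightarrow> x \<in> A \<and> y \<in> B \<and> E x y"
      if "x \<in> pverts G" "y \<in> pverts G" for x y
    proof (cases "x \<in> A \<and> y \<in> B")
      case True
      then have "y \<notin> A" using disj by auto
      with True I(3)[of y x] show ?thesis
        by (auto simp: row_in_column_def word_def inj_map_eq_map[OF inj_prod_encode])
    next
      case False
      then show ?thesis using that V by (auto simp: row_in_column_def word_def)
    qed
    have adj: "(x, y) \<in> parcs G \<longleftrightarrow> f (encode (word x)) (encode (word y))"
      if "x \<in> pverts G" "y \<in> pverts G" for x y
      using row[OF that] row[OF that(2,1)] bg.E_sides[of x y] bg.E_sym
      unfolding f_def E_def by blast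
    show "\<exists>code. (\<forall>x\<in>pverts G. real (length (code x)) \<le> c * log 2 (real n)) \<and>
        (\<forall>x\<in>pverts G. \<forall>y\<in>pverts G. x \<noteq> y \<longrightarrow> ((x, y) \<in> parcs G \<longleftrightarrow> f (code x) (code y)))"
      using len adj by (intro exI[of _ "\<lambda>x. encode (word x)"]) blast
  qed
qed

end
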